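(* Let $M\ge 1$ be an integer, $N=2M-1$, $\sigma>0$, and let $s\sim\mathcal{N}(0,\sigma^2)$ be a real Gaussian random variable. Let $A$ and $B$ be the $M\times M$ Hankel matrices generated from the even moments of $s$, $$A_{ij}=E\big(s^{2(i+j-2)}\big),\qquad B_{ij}=E\big(s^{2(i+j-1)}\big),\qquad 1\le i,j\le M.$$ Let $D=\operatorname{diag}(1,3,5,\dots,N)$ and $D_\sigma=\operatorname{diag}(1,\sigma^2,\sigma^4,\dots,\sigma^{N-1})$. Then $$A=D_\sigma A_0D_\sigma,\qquad B=\sigma^2D_\sigma B_0D_\sigma,$$ where $A_0$ and $B_0$ denote the matrices $A$ and $B$ in the case $\sigma=1$, which are given explicitly by $$(A_0)_{ij}=(2(i+j)-5)!!,\qquad (B_0)_{ij}=(2(i+j)-3)!!,\qquad 1\le i,j\le M.$$ Moreover, if $B=LL^{T}$ is the Cholesky decomposition of $B$, then $$L^{-1}DAD\,L^{-T}=\sigma^{-2}D,$$ or equivalently, $$DAD=\sigma^{-2}LDL^{T}.$$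
   Context: $n!!$ denotes the double factorial of the odd integer $n$ ($n!!=n(n-2)\cdots 3\cdot 1$), with the convention $(-1)!!=1$. The Cholesky decomposition $B=LL^T$ is the one with $L$ real lower triangular with positive diagonal entries. $L^{-T}$ denotes $(L^{-1})^T$. $E(\cdot)$ denotes expectation. *)

theory Defs
  imports "HOL-Probability.Probability" "Jordan_Normal_Form.Gauss_Jordan_Elimination"
begin

text \<open>Entries of \<^typ>\<open>'a mat\<close> are indexed from 0; this constructor takes the entry
  function with indices \<open>1 \<le> i, j \<le> n\<close>.\<close>

definition mat1 :: "nat \<Rightarrow> (nat \<Rightarrow> nat \<Rightarrow> 'a) \<Rightarrow> 'a mat" where
  "mat1 n f = Matrix.mat n n (\<lambda>(i, j). f (Suc i) (Suc j))"

definition diag1 :: "nat \<Rightarrow> (nat \<Rightarrow> 'a::zero) \<Rightarrow> 'a mat" where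
  "diag1 n d = mat_diag n (\<lambda>i. d (Suc i))"

text \<open>Double factorial, on integers so that \<open>(-1)!! = 1\<close> can be expressed. Only odd arguments
  \<open>\<ge> -1\<close> are meant; elsewhere the value is merely a convention.\<close>

function double_fact :: "int \<Rightarrow> nat" where
  "double_fact n = (if n \<le> 0 then 1 else nat n * double_fact (n - 2))"
  by pat_completeness auto
termination by (relation "Wellfounded.measure nat") auto

declare double_fact.simps [simp del]

text \<open>The exponents below are never truncated, because \<open>i + j \<ge> 2\<close>.\<close>

definition moment_mat_A :: "'a measure \<Rightarrow> ('a \<Rightarrow> real) \<Rightarrow> nat \<Rightarrow> real mat" where
  "moment_mat_A P s M = mat1 M (\<lambda>i j. \<integral>\<omega>. s \<omega> ^ (2 * (i + j - 2)) \<partial>P)"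

definition moment_mat_B :: "'a measure \<Rightarrow> ('a \<Rightarrow> real) \<Rightarrow> nat \<Rightarrow> real mat" where
  "moment_mat_B P s M = mat1 M (\<lambda>i j. \<integral>\<omega>. s \<omega> ^ (2 * (i + j - 1)) \<partial>P)"

definition lower_triangular :: "'a::zero mat \<Rightarrow> bool" where
  "lower_triangular L \<longleftrightarrow> (\<forall>i<dim_row L. \<forall>j<dim_col L. i < j \<longrightarrow> L $$ (i, j) = 0)"

definition cholesky :: "nat \<Rightarrow> real mat \<Rightarrow> real mat \<Rightarrow> bool" where
  "cholesky n B L \<longleftrightarrow>
     L \<in> carrier_mat n n \<and> lower_triangular L \<and> (\<forall>i<n. L $$ (i, i) > 0) \<and>
     B = L * transpose_mat L"

text \<open>Unspecified if the matrix is singular.\<close>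

definition inv_mat :: "'a::field mat \<Rightarrow> 'a mat" where
  "inv_mat L = the (mat_inverse L)"

end

theory Submission
  imports Defs "Jordan_Normal_Form.Determinant"
begin

text \<open>Expand \<open>x\<^sup>n = (\<Sum>k. a n k * He k x)\<close> in the Hermite polynomials, which are orthogonal for the
  standard Gaussian weight with squared norms \<open>k!\<close>. For odd powers this expansion exhibits the
  Cholesky factor of \<open>B0\<close>. Differentiating the expansion, with \<open>He' (k + 1) = (k + 1) He k\<close>,
  turns it into the expansion of the even powers behind \<open>A0\<close>, whose Gram matrix therefore becomes
  \<open>L D L\<^sup>T\<close> after scaling by \<open>D\<close>. Everything is phrased purely in terms of the coefficients \<open>a\<close>, whose
  recursion is the three-term recurrence \<open>x He k = He (k + 1) + k He (k - 1)\<close>.\<close>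

subsection \<open>Monomials in the Hermite basis\<close>

fun hermite_coeff :: "nat \<Rightarrow> nat \<Rightarrow> real" where
  "hermite_coeff 0 k = (if k = 0 then 1 else 0)"
| "hermite_coeff (Suc n) 0 = hermite_coeff n 1"
| "hermite_coeff (Suc n) (Suc k) = hermite_coeff n k + real (k + 2) * hermite_coeff n (k + 2)"

lemma hermite_coeff_eq_0: "n < k \<Longrightarrow> hermite_coeff n k = 0"
proof (induction n arbitrary: k)
  case (Suc n)
  then show ?case by (cases k) auto
qed auto

lemma hermite_coeff_diag [simp]: "hermite_coeff n n = 1"
  by (induction n) (auto simp: hermite_coeff_eq_0)

text \<open>Each step of the recursion changes both indices by an odd amount. This separates odd
  powers, which produce \<open>B0\<close>, from even powers, which produce
  \<open>A0\<close>.\<close>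

lemma hermite_coeff_parity: "odd (n + k) \<Longrightarrow> hermite_coeff n k = 0"
proof (induction n arbitrary: k)
  case (Suc n)
  then show ?case by (cases k) auto
qed (auto intro: odd_pos)

text \<open>The derivative of the expansion of \<open>x\<^sup>n\<^sup>+\<^sup>1\<close>.\<close>

lemma hermite_coeff_deriv:
  "real (k + 1) * hermite_coeff (Suc n) (Suc k) = real (n + 1) * hermite_coeff n k"
proof (induction n arbitrary: k)
  case 0
  show ?case by (cases k) auto
next
  case (Suc n)
  have 2: "real (k + 2) * hermite_coeff (Suc n) (k + 2) = real (n + 1) * hermite_coeff n (k + 1)"
    using Suc[of "k + 1"] by (simp add: numeral_2_eq_2)
  \<comment> \<open>The induction hypothesis at \<open>k - 1\<close>, with
    \<open>hermite_coeff n (k - 1)\<close> expressed through the recursion. For \<open>k = 0\<close>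
    the bracket vanishes. The terms in \<open>hermite_coeff n (k + 1)\<close> from \<open>1\<close>
    and \<open>2\<close> then cancel.\<close>
  have 1: "real k * hermite_coeff (Suc n) k
      = real (n + 1) * (hermite_coeff (Suc n) k - real (k + 1) * hermite_coeff n (k + 1))"
  proof (cases k)
    case (Suc l)
    then show ?thesis using Suc.IH[of l] by (simp add: algebra_simps)
  qed simp
  have "real (k + 1) * hermite_coeff (Suc (Suc n)) (Suc k)
      = hermite_coeff (Suc n) k + real k * hermite_coeff (Suc n) k
        + real (k + 1) * (real (k + 2) * hermite_coeff (Suc n) (k + 2))"
    by (simp add: algebra_simps)
  also have "\<dots> = real (Suc n + 1) * hermite_coeff (Suc n) k"
    unfolding 1 2 by (simp add: algebra_simps)
  finally show ?case .
qed

text \<open>The constant coefficient is the standard Gaussian moment. One recursion step followed by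
  the derivative rule at \<open>k = 0\<close> gives the ratio \<open>2 * n + 1\<close>, which is
  also that of successive odd double factorials.\<close>

lemma hermite_coeff_0: "hermite_coeff (2 * n) 0 = fact (2 * n) / (2 ^ n * fact n)"
proof (induction n)
  case (Suc n)
  have "hermite_coeff (2 * Suc n) 0 = real (2 * n + 1) * hermite_coeff (2 * n) 0"
    using hermite_coeff_deriv[of 0 "2 * n"] by simp
  also have "\<dots> = fact (2 * Suc n) / (2 ^ Suc n * fact (Suc n))"
    unfolding Suc using of_nat_neq_0[of n, where ?'a = real]
    by (simp add: divide_simps)
  finally show ?case .
qed simp

lemma double_fact_eq_hermite_coeff:
  "real (double_fact (2 * int n - 1)) = hermite_coeff (2 * n) 0"
proof (induction n)
  case (Suc n)
  have "double_fact (2 * int (Suc n) - 1) = (2 * n + 1) * double_fact (2 * int n - 1)"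
    by (subst double_fact.simps) (simp add: nat_add_distrib nat_mult_distrib)
  then have "real (double_fact (2 * int (Suc n) - 1))
      = real (2 * n + 1) * hermite_coeff (2 * n) 0"
    using Suc by (simp add: algebra_simps)
  also have "\<dots> = hermite_coeff (2 * Suc n) 0"
    using hermite_coeff_deriv[of 0 "2 * n"] by simp
  finally show ?case .
qed (simp add: double_fact.simps)

text \<open>The right-hand side is symmetric in \<open>m\<close> and \<open>n\<close>, so the factor
  x may be moved from one monomial to the other.\<close>

lemma hermite_coeff_shift_sum:
  assumes "m < K" "n < K"
  shows "(\<Sum>k<K. fact k * hermite_coeff (Suc m) k * hermite_coeff n k) =
    (\<Sum>k<K. fact (Suc k) * (hermite_coeff m k * hermite_coeff n (Suc k)
                           + hermite_coeff m (Suc k) * hermite_coeff n k))"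
proof -
  obtain K' where K: "K = Suc K'" using assms by (cases K) auto
  have z: "hermite_coeff n (Suc K') = 0" "hermite_coeff m (Suc K') = 0"
    using assms K by (auto intro: hermite_coeff_eq_0)
  \<comment> \<open>The factor \<open>k + 2\<close> of the recursion turns \<open>(k + 1)!\<close>
    into \<open>(k + 2)!\<close>.\<close>
  have "(\<Sum>k<K. fact k * hermite_coeff (Suc m) k * hermite_coeff n k)
      = hermite_coeff m 1 * hermite_coeff n 0
        + (\<Sum>k<K'. fact (Suc k) * (hermite_coeff m k * hermite_coeff n (Suc k)))
        + (\<Sum>k<K'. fact (Suc (Suc k)) * (hermite_coeff m (Suc (Suc k)) * hermite_coeff n (Suc k)))"
    unfolding K by (subst sum.lessThan_Suc_shift) (simp add: sum.distrib[symmetric] algebra_simps)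
  \<comment> \<open>The first sum gains a term that is zero by \<open>z\<close>; the second absorbs
    the isolated product as its term at 0.\<close>
  also have "\<dots> = (\<Sum>k<K. fact (Suc k) * (hermite_coeff m k * hermite_coeff n (Suc k)))
        + (\<Sum>k<K. fact (Suc k) * (hermite_coeff m (Suc k) * hermite_coeff n k))"
    unfolding K sum.lessThan_Suc[of "\<lambda>k. fact (Suc k) * (hermite_coeff m k * hermite_coeff n (Suc k))"]
      sum.lessThan_Suc_shift[of "\<lambda>k. fact (Suc k) * (hermite_coeff m (Suc k) * hermite_coeff n k)"]
    using z by simp
  finally show ?thesis by (simp add: sum.distrib ring_distribs)
qed

text \<open>Multiplication by \<open>x\<close> is self-adjoint, so the Gram matrix of the monomials is a Hankel matrix.\<close>

lemma hermite_coeff_gram: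
  assumes "m + n < K"
  shows "(\<Sum>k<K. fact k * hermite_coeff m k * hermite_coeff n k) = hermite_coeff (m + n) 0"
  using assms
proof (induction m arbitrary: n)
  case 0
  have "(\<Sum>k<K. fact k * hermite_coeff 0 k * hermite_coeff n k)
      = (\<Sum>k<K. if k = 0 then hermite_coeff n 0 else 0)"
    by (intro sum.cong) auto
  with 0 show ?case by simp
next
  case (Suc m)
  have "(\<Sum>k<K. fact k * hermite_coeff (Suc m) k * hermite_coeff n k)
      = (\<Sum>k<K. fact k * hermite_coeff (Suc n) k * hermite_coeff m k)"
    using Suc.prems
    by (subst (1 2) hermite_coeff_shift_sum) (simp_all add: algebra_simps del: hermite_coeff.simps)
  also have "\<dots> = hermite_coeff (m + Suc n) 0"
    using Suc.IH[of "Suc n"] Suc.prems by (simp add: mult.commute mult.left_commute)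
  finally show ?case by simp
qed

section \<open>Gram matrices of the even and the odd powers\<close>

lemma sum_lessThan_double:
  fixes f :: "nat \<Rightarrow> 'a::comm_monoid_add"
  shows "(\<Sum>k<2 * n. f k) = (\<Sum>k<n. f (2 * k) + f (2 * k + 1))"
  by (induction n) (auto simp: add.assoc)

lemma hermite_coeff_gram_even:
  assumes "i < K" "j < K"
  shows "(\<Sum>k<K. fact (2 * k) * hermite_coeff (2 * i) (2 * k) * hermite_coeff (2 * j) (2 * k))
    = hermite_coeff (2 * (i + j)) 0"
proof -
  let ?f = "\<lambda>k. fact (2 * k) * hermite_coeff (2 * i) (2 * k) * hermite_coeff (2 * j) (2 * k)"
  \<comment> \<open>The cutoff \<open>2 * (K + K)\<close> exceeds the total degree, as
    \<open>hermite_coeff_gram\<close> requires. Parity removes half of the terms, and those with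
    index at least \<open>K\<close> vanish by degree.\<close>
  have "hermite_coeff (2 * (i + j)) 0
      = (\<Sum>k<2 * (K + K). fact k * hermite_coeff (2 * i) k * hermite_coeff (2 * j) k)"
    using assms hermite_coeff_gram[of "2 * i" "2 * j" "2 * (K + K)"] by simp
  also have "\<dots> = (\<Sum>k<K + K. ?f k)"
    unfolding sum_lessThan_double by (simp add: hermite_coeff_parity)
  also have "\<dots> = (\<Sum>k<K. ?f k)"
    using assms by (intro sum.mono_neutral_right) (auto simp: hermite_coeff_eq_0)
  finally show ?thesis by simp
qed

lemma hermite_coeff_gram_odd:
  assumes "i < K" "j < K"
  shows "(\<Sum>k<K. fact (2 * k + 1) * hermite_coeff (2 * i + 1) (2 * k + 1)
                                * hermite_coeff (2 * j + 1) (2 * k + 1))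
    = hermite_coeff (2 * (i + j + 1)) 0"
proof -
  let ?f = "\<lambda>k. fact (2 * k + 1) * hermite_coeff (2 * i + 1) (2 * k + 1)
                                * hermite_coeff (2 * j + 1) (2 * k + 1)"
  have "hermite_coeff (2 * (i + j + 1)) 0
      = (\<Sum>k<2 * (K + K). fact k * hermite_coeff (2 * i + 1) k * hermite_coeff (2 * j + 1) k)"
    using assms hermite_coeff_gram[of "2 * i + 1" "2 * j + 1" "2 * (K + K)"]
    by (simp add: algebra_simps del: hermite_coeff.simps)
  also have "\<dots> = (\<Sum>k<K + K. ?f k)"
    unfolding sum_lessThan_double
    by (intro sum.cong refl) (simp add: hermite_coeff_parity del: hermite_coeff.simps)
  also have "\<dots> = (\<Sum>k<K. ?f k)"
    using assms
    by (intro sum.mono_neutral_right) (auto simp: hermite_coeff_eq_0 simp del: hermite_coeff.simps)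
  finally show ?thesis by (simp del: hermite_coeff.simps)
qed

text \<open>Since \<open>(2k+1) (2k+1)! = (2k)! (2k+1)^2\<close>, each coefficient receives one
  factor \<open>2k+1\<close>. The derivative rule trades it for \<open>2i+1\<close> or
  \<open>2j+1\<close> and lowers the powers to even ones.\<close>

lemma hermite_coeff_gram_deriv:
  assumes "i < K" "j < K"
  shows "(\<Sum>k<K. real (2 * k + 1) * fact (2 * k + 1) * hermite_coeff (2 * i + 1) (2 * k + 1)
                                * hermite_coeff (2 * j + 1) (2 * k + 1))
    = real (2 * i + 1) * real (2 * j + 1) * hermite_coeff (2 * (i + j)) 0"
proof -
  have *: "real (2 * k + 1) * hermite_coeff (2 * i + 1) (2 * k + 1)
      = real (2 * i + 1) * hermite_coeff (2 * i) (2 * k)" for i k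
    using hermite_coeff_deriv[of "2 * k" "2 * i"] by simp
  have "real (2 * k + 1) * fact (2 * k + 1) * hermite_coeff (2 * i + 1) (2 * k + 1)
          * hermite_coeff (2 * j + 1) (2 * k + 1)
      = fact (2 * k) * (real (2 * k + 1) * hermite_coeff (2 * i + 1) (2 * k + 1))
          * (real (2 * k + 1) * hermite_coeff (2 * j + 1) (2 * k + 1))" for k
    by (simp del: hermite_coeff.simps)
  then show ?thesis
    unfolding hermite_coeff_gram_even[OF assms, symmetric] * sum_distrib_left
    by (simp add: mult_ac del: hermite_coeff.simps)
qed

subsection \<open>Gaussian moments\<close>

lemma normal_moment_hermite_coeff:
  assumes "\<sigma> > 0" "distributed P lborel s (normal_density 0 \<sigma>)"
  shows "(\<integral>\<omega>. s \<omega> ^ (2 * n) \<partial>P) = \<sigma> ^ (2 * n) * hermite_coeff (2 * n) 0"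
proof -
  have "(\<integral>\<omega>. s \<omega> ^ (2 * n) \<partial>P) = (\<integral>x. normal_density 0 \<sigma> x * x ^ (2 * n) \<partial>lborel)"
    using assms by (subst distributed_integral[symmetric]) auto
  also have "\<dots> = fact (2 * n) / ((2 / \<sigma>\<^sup>2) ^ n * fact n)"
    using normal_moment_even[OF assms(1), of 0 n]
    by (simp add: has_bochner_integral_integral_eq)
  also have "\<dots> = \<sigma> ^ (2 * n) * hermite_coeff (2 * n) 0"
    unfolding hermite_coeff_0 by (simp add: power_divide power_mult)
  finally show ?thesis .
qed

lemma moment_mat_A_eq:
  assumes "\<sigma> > 0" "distributed P lborel s (normal_density 0 \<sigma>)"
  shows "moment_mat_A P s M
    = Matrix.mat M M (\<lambda>(i, j). \<sigma> ^ (2 * (i + j)) * hermite_coeff (2 * (i + j)) 0)"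
  unfolding moment_mat_A_def mat1_def
  using normal_moment_hermite_coeff[OF assms, of "_ + _"] by (intro cong_mat) auto

lemma moment_mat_B_eq:
  assumes "\<sigma> > 0" "distributed P lborel s (normal_density 0 \<sigma>)"
  shows "moment_mat_B P s M
    = Matrix.mat M M (\<lambda>(i, j). \<sigma> ^ (2 * (i + j + 1)) * hermite_coeff (2 * (i + j + 1)) 0)"
  unfolding moment_mat_B_def mat1_def
  using normal_moment_hermite_coeff[OF assms, of "_ + _ + 1"] by (intro cong_mat) auto

subsection \<open>Uniqueness of the Cholesky factor\<close>

text \<open>Triangularity of row \<open>j\<close> cuts the sum at \<open>j\<close>, so column
  \<open>j\<close> depends only on the columns before it.\<close>

lemma cholesky_entry:
  assumes "cholesky n B L" "j \<le> i" "i < n"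
  shows "B $$ (i, j) = (\<Sum>k<j. L $$ (i, k) * L $$ (j, k)) + L $$ (i, j) * L $$ (j, j)"
proof -
  have L: "L \<in> carrier_mat n n" and lt: "lower_triangular L" and B: "B = L * transpose_mat L"
    using assms(1) by (auto simp: cholesky_def)
  have "B $$ (i, j) = (\<Sum>k<n. L $$ (i, k) * L $$ (j, k))"
    using L assms(2,3) by (simp add: B scalar_prod_def atLeast0LessThan)
  also have "\<dots> = (\<Sum>k<Suc j. L $$ (i, k) * L $$ (j, k))"
    using L lt assms(2,3)
    by (intro sum.mono_neutral_right) (auto simp: lower_triangular_def)
  finally show ?thesis by simp
qed

text \<open>Columns agree from left to right: the diagonal entry is known up to sign, positivity
  fixes the sign, and division by it gives the entries below.\<close>

lemma cholesky_unique:
  assumes L: "cholesky n B L" and K: "cholesky n B K"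
  shows "L = K"
proof -
  have pos: "0 < L $$ (i, i)" "0 < K $$ (i, i)" if "i < n" for i
    using assms that by (auto simp: cholesky_def)
  have *: "\<forall>i<n. j \<le> i \<longrightarrow> L $$ (i, j) = K $$ (i, j)" if "j < n" for j
    using that
  proof (induction j rule: less_induct)
    case (less j)
    have eq: "L $$ (i, j) * L $$ (j, j) = K $$ (i, j) * K $$ (j, j)" if "i < n" "j \<le> i" for i
    proof -
      have "(\<Sum>k<j. L $$ (i, k) * L $$ (j, k)) = (\<Sum>k<j. K $$ (i, k) * K $$ (j, k))"
        using less that by (intro sum.cong) auto
      then show ?thesis
        using cholesky_entry[OF L that(2,1)] cholesky_entry[OF K that(2,1)] by simp
    qed
    have "(L $$ (j, j))\<^sup>2 = (K $$ (j, j))\<^sup>2"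
      using eq[of j] less.prems by (simp add: power2_eq_square)
    then have "L $$ (j, j) = K $$ (j, j)"
      using pos[OF less.prems] by (simp add: power2_eq_iff_nonneg)
    with eq pos[OF less.prems] show ?case by auto
  qed
  have "L $$ (i, j) = K $$ (i, j)" if "i < n" "j < n" for i j
    using * assms that by (cases "j \<le> i") (auto simp: cholesky_def lower_triangular_def)
  then show ?thesis
    using assms by (intro eq_matI) (auto simp: cholesky_def)
qed

section \<open>Inverting the Cholesky factor\<close>

lemma inv_mat_inverts:
  fixes L :: "'a::field mat"
  assumes "L \<in> carrier_mat n n" "det L \<noteq> 0"
  shows "inv_mat L \<in> carrier_mat n n" "inv_mat L * L = 1\<^sub>m n"
proof -
  obtain X where X: "mat_inverse L = Some X"
    using mat_inverse(1)[OF assms(1)] det_non_zero_imp_unit[OF assms] by fastforce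
  then show "inv_mat L \<in> carrier_mat n n" "inv_mat L * L = 1\<^sub>m n"
    using mat_inverse(2)[OF assms(1) X] by (auto simp: inv_mat_def)
qed

lemma cholesky_det_nonzero:
  assumes "cholesky n B L"
  shows "det L \<noteq> 0"
proof -
  have L: "L \<in> carrier_mat n n" using assms by (simp add: cholesky_def)
  have "det L = prod_list (diag_mat L)"
    using assms by (intro det_lower_triangular[OF _ L]) (auto simp: cholesky_def lower_triangular_def)
  also have "\<dots> \<noteq> 0"
    using assms L by (auto simp: prod_list_zero_iff diag_mat_def cholesky_def)
  finally show ?thesis .
qed

lemma inv_mat_congruence:
  fixes L :: "'a::field mat"
  assumes L: "L \<in> carrier_mat n n" "det L \<noteq> 0" and D: "D \<in> carrier_mat n n"
  shows "inv_mat L * (L * D * transpose_mat L) * transpose_mat (inv_mat L) = D"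
proof -
  note X = inv_mat_inverts[OF L]
  have "inv_mat L * (L * D * transpose_mat L) * transpose_mat (inv_mat L)
      = (inv_mat L * L) * D * transpose_mat (inv_mat L * L)"
    using X(1) L(1) D by (simp add: transpose_mult[of _ n n] assoc_mult_mat[of _ n n _ n _ n])
  then show ?thesis using X D by simp
qed

subsection \<open>The Gaussian Hankel matrices\<close>

text \<open>Row \<open>i\<close> expands the power \<open>2 * i + 1\<close> of \<sigma> x in the
  normalized odd Hermite polynomials; the square root is the norm of the polynomial of degree
  \<open>2 * k + 1\<close>.\<close>

definition gauss_cholesky :: "real \<Rightarrow> nat \<Rightarrow> real mat" where
  "gauss_cholesky \<sigma> M = Matrix.mat M M (\<lambda>(i, k).
     \<sigma> ^ (2 * i + 1) * hermite_coeff (2 * i + 1) (2 * k + 1) * sqrt (fact (2 * k + 1)))"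

text \<open>The product is the odd Gram identity. Degree gives triangularity, and leading
  coefficient 1 gives the positive diagonal.\<close>

lemma cholesky_gauss_cholesky:
  assumes "\<sigma> > 0" "distributed P lborel s (normal_density 0 \<sigma>)"
  shows "cholesky M (moment_mat_B P s M) (gauss_cholesky \<sigma> M)"
proof -
  let ?L = "gauss_cholesky \<sigma> M"
  have "moment_mat_B P s M = ?L * transpose_mat ?L"
  proof (rule eq_matI)
    fix i j assume "i < dim_row (?L * transpose_mat ?L)" "j < dim_col (?L * transpose_mat ?L)"
    then have ij: "i < M" "j < M" by (auto simp: gauss_cholesky_def)
    let ?f = "\<lambda>k. fact (2 * k + 1) * hermite_coeff (2 * i + 1) (2 * k + 1)
                                   * hermite_coeff (2 * j + 1) (2 * k + 1)"
    have "(?L * transpose_mat ?L) $$ (i, j) = (\<Sum>k<M. ?L $$ (i, k) * ?L $$ (j, k))"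
      using ij by (simp add: gauss_cholesky_def scalar_prod_def atLeast0LessThan)
    also have "\<dots> = (\<Sum>k<M. \<sigma> ^ (2 * (i + j + 1)) * ?f k)"
    proof (rule sum.cong[OF refl])
      fix k assume "k \<in> {..<M}"
      moreover have "sqrt (fact (2 * k + 1)) * sqrt (fact (2 * k + 1)) = fact (2 * k + 1)"
        by (rule real_sqrt_mult_self[THEN trans]) simp
      moreover have "\<sigma> ^ (2 * (i + j + 1)) = \<sigma> ^ (2 * i + 1) * \<sigma> ^ (2 * j + 1)"
        by (simp add: power_add[symmetric])
      ultimately show "?L $$ (i, k) * ?L $$ (j, k) = \<sigma> ^ (2 * (i + j + 1)) * ?f k"
        using ij
        by (simp add: gauss_cholesky_def mult_ac del: fact_Suc hermite_coeff.simps power_Suc)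
    qed
    also have "\<dots> = moment_mat_B P s M $$ (i, j)"
      unfolding sum_distrib_left[symmetric] hermite_coeff_gram_odd[OF ij] moment_mat_B_eq[OF assms]
      using ij by (simp del: hermite_coeff.simps)
    finally show "moment_mat_B P s M $$ (i, j) = (?L * transpose_mat ?L) $$ (i, j)" by simp
  qed (auto simp: gauss_cholesky_def moment_mat_B_def mat1_def)
  then show ?thesis
    using assms(1)
    by (auto simp: cholesky_def lower_triangular_def gauss_cholesky_def hermite_coeff_eq_0
        simp del: hermite_coeff.simps)
qed

lemma diag1_mult_mult:
  fixes d :: "nat \<Rightarrow> 'a::comm_semiring_1"
  assumes "i < n" "j < n" "X \<in> carrier_mat n n"
  shows "(diag1 n d * X * diag1 n d) $$ (i, j) = d (Suc i) * X $$ (i, j) * d (Suc j)"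
  using assms by (simp add: diag1_def mat_diag_mult_left[of _ n n] mat_diag_mult_right[of _ n n])

text \<open>Inserting \<open>D\<close> weights the odd Gram sum by \<open>2 * k + 1\<close>, which
  \<open>hermite_coeff_gram_deriv\<close> evaluates. The two rows carry one factor \<sigma> each
  beyond the powers in \<open>A\<close>, hence the scalar.\<close>

lemma gauss_cholesky_diag:
  fixes M :: nat
  assumes "\<sigma> > 0" "distributed P lborel s (normal_density 0 \<sigma>)"
  defines "D \<equiv> diag1 M (\<lambda>i. real (2 * i - 1))"
  shows "D * moment_mat_A P s M * D
    = (1 / \<sigma>\<^sup>2) \<cdot>\<^sub>m (gauss_cholesky \<sigma> M * D * transpose_mat (gauss_cholesky \<sigma> M))"
    (is "_ = _ \<cdot>\<^sub>m (?L * D * _)")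
proof (rule eq_matI)
  have L: "?L \<in> carrier_mat M M" and A: "moment_mat_A P s M \<in> carrier_mat M M"
    by (auto simp: gauss_cholesky_def moment_mat_A_def mat1_def)
  have D: "D \<in> carrier_mat M M" by (simp add: D_def diag1_def)
  fix i j assume "i < dim_row ((1 / \<sigma>\<^sup>2) \<cdot>\<^sub>m (?L * D * transpose_mat ?L))"
    "j < dim_col ((1 / \<sigma>\<^sup>2) \<cdot>\<^sub>m (?L * D * transpose_mat ?L))"
  then have ij: "i < M" "j < M" using L D by auto
  let ?f = "\<lambda>k. real (2 * k + 1) * fact (2 * k + 1) * hermite_coeff (2 * i + 1) (2 * k + 1)
                                 * hermite_coeff (2 * j + 1) (2 * k + 1)"
  have "(?L * D * transpose_mat ?L) $$ (i, j)
      = (\<Sum>k<M. ?L $$ (i, k) * real (2 * k + 1) * ?L $$ (j, k))"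
    using ij L
    by (simp add: D_def diag1_def mat_diag_mult_right[of _ M M] scalar_prod_def atLeast0LessThan)
  also have "\<dots> = (\<Sum>k<M. \<sigma>\<^sup>2 * \<sigma> ^ (2 * (i + j)) * ?f k)"
  proof (rule sum.cong[OF refl])
    fix k assume "k \<in> {..<M}"
    moreover have "sqrt (fact (2 * k + 1)) * sqrt (fact (2 * k + 1)) = fact (2 * k + 1)"
      by (rule real_sqrt_mult_self[THEN trans]) simp
    moreover have "\<sigma>\<^sup>2 * \<sigma> ^ (2 * (i + j)) = \<sigma> ^ (2 * i + 1) * \<sigma> ^ (2 * j + 1)"
      by (simp add: power_add[symmetric])
    ultimately show "?L $$ (i, k) * real (2 * k + 1) * ?L $$ (j, k)
        = \<sigma>\<^sup>2 * \<sigma> ^ (2 * (i + j)) * ?f k"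
      using ij
      by (simp add: gauss_cholesky_def mult_ac del: fact_Suc hermite_coeff.simps power_Suc)
  qed
  also have "\<dots> = \<sigma>\<^sup>2 * (D * moment_mat_A P s M * D) $$ (i, j)"
    unfolding sum_distrib_left[symmetric] hermite_coeff_gram_deriv[OF ij]
    unfolding D_def diag1_mult_mult[OF ij A]
    using ij by (simp add: moment_mat_A_eq[OF assms(1,2)])
  finally show "(D * moment_mat_A P s M * D) $$ (i, j)
      = ((1 / \<sigma>\<^sup>2) \<cdot>\<^sub>m (?L * D * transpose_mat ?L)) $$ (i, j)"
    using ij L D assms(1) by simp
qed (auto simp: D_def diag1_def gauss_cholesky_def mat_diag_def)

theorem theorem1:
  fixes M :: nat and \<sigma> :: real
    and P :: "'a measure" and s :: "'a \<Rightarrow> real"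
    and P0 :: "'b measure" and s0 :: "'b \<Rightarrow> real"
    and A B A0 B0 D D\<sigma> :: "real mat"
  assumes "M \<ge> 1" and "\<sigma> > 0"
    and "prob_space P" and "distributed P lborel s (normal_density 0 \<sigma>)"
    and "prob_space P0" and "distributed P0 lborel s0 (normal_density 0 1)"
    and "A = moment_mat_A P s M" and "B = moment_mat_B P s M"
    and "A0 = moment_mat_A P0 s0 M" and "B0 = moment_mat_B P0 s0 M"
    and "D = diag1 M (\<lambda>i. real (2 * i - 1))"
    and "D\<sigma> = diag1 M (\<lambda>i. \<sigma> ^ (2 * (i - 1)))"
  shows "A = D\<sigma> * A0 * D\<sigma> \<and>
    B = \<sigma>\<^sup>2 \<cdot>\<^sub>m (D\<sigma> * B0 * D\<sigma>) \<and>
    A0 = mat1 M (\<lambda>i j. real (double_fact (2 * (int i + int j) - 5))) \<and>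
    B0 = mat1 M (\<lambda>i j. real (double_fact (2 * (int i + int j) - 3))) \<and>
    (\<forall>L. cholesky M B L \<longrightarrow>
       inv_mat L * (D * A * D) * transpose_mat (inv_mat L) = (1 / \<sigma>\<^sup>2) \<cdot>\<^sub>m D \<and>
       D * A * D = (1 / \<sigma>\<^sup>2) \<cdot>\<^sub>m (L * D * transpose_mat L))"
proof (intro conjI allI impI)
  have A: "A = Matrix.mat M M (\<lambda>(i, j). \<sigma> ^ (2 * (i + j)) * hermite_coeff (2 * (i + j)) 0)"
    and B: "B = Matrix.mat M M (\<lambda>(i, j). \<sigma> ^ (2 * (i + j + 1)) * hermite_coeff (2 * (i + j + 1)) 0)"
    using moment_mat_A_eq moment_mat_B_eq assms by blast+
  have A0: "A0 = Matrix.mat M M (\<lambda>(i, j). hermite_coeff (2 * (i + j)) 0)"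
    and B0: "B0 = Matrix.mat M M (\<lambda>(i, j). hermite_coeff (2 * (i + j + 1)) 0)"
    using moment_mat_A_eq[OF _ assms(6)] moment_mat_B_eq[OF _ assms(6)] assms(9,10)
    by (simp_all del: hermite_coeff.simps)
  have D\<sigma>: "(D\<sigma> * X * D\<sigma>) $$ (i, j) = \<sigma> ^ (2 * (i + j)) * X $$ (i, j)"
    if "i < M" "j < M" "X \<in> carrier_mat M M" for i j X
    unfolding assms(12) diag1_mult_mult[OF that] by (simp add: power_add algebra_simps)
  have dims: "D\<sigma> \<in> carrier_mat M M" by (simp add: assms(12) diag1_def)
  show "A = D\<sigma> * A0 * D\<sigma>"
  proof (rule eq_matI)
    fix i j assume "i < dim_row (D\<sigma> * A0 * D\<sigma>)" "j < dim_col (D\<sigma> * A0 * D\<sigma>)"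
    then have ij: "i < M" "j < M" using dims by auto
    moreover have "A0 \<in> carrier_mat M M" by (simp add: A0)
    ultimately show "A $$ (i, j) = (D\<sigma> * A0 * D\<sigma>) $$ (i, j)"
      using D\<sigma>[OF ij, of A0] by (simp add: A A0 del: hermite_coeff.simps)
  qed (use dims in \<open>auto simp: A\<close>)
  show "B = \<sigma>\<^sup>2 \<cdot>\<^sub>m (D\<sigma> * B0 * D\<sigma>)"
  proof (rule eq_matI)
    fix i j assume "i < dim_row (\<sigma>\<^sup>2 \<cdot>\<^sub>m (D\<sigma> * B0 * D\<sigma>))" "j < dim_col (\<sigma>\<^sup>2 \<cdot>\<^sub>m (D\<sigma> * B0 * D\<sigma>))"
    then have ij: "i < M" "j < M" using dims by auto
    moreover have "B0 \<in> carrier_mat M M" by (simp add: B0)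
    moreover have "\<sigma> ^ (2 * (i + j + 1)) = \<sigma>\<^sup>2 * \<sigma> ^ (2 * (i + j))"
      by (simp add: power_add[symmetric] power2_eq_square)
    ultimately show "B $$ (i, j) = (\<sigma>\<^sup>2 \<cdot>\<^sub>m (D\<sigma> * B0 * D\<sigma>)) $$ (i, j)"
      using dims D\<sigma>[OF ij, of B0] by (simp add: B B0 power2_eq_square del: hermite_coeff.simps)
  qed (use dims in \<open>auto simp: B\<close>)
  \<comment> \<open>Passing to indices from 0 gives the form \<open>2 * int n - 1\<close>; the
    corner entry of \<open>A0\<close> is \<open>(-1)!!\<close>.\<close>
  have "2 * (int (Suc i) + int (Suc j)) - 5 = 2 * int (i + j) - 1"
    "2 * (int (Suc i) + int (Suc j)) - 3 = 2 * int (i + j + 1) - 1" for i j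
    by simp_all
  then show "A0 = mat1 M (\<lambda>i j. real (double_fact (2 * (int i + int j) - 5)))"
    and "B0 = mat1 M (\<lambda>i j. real (double_fact (2 * (int i + int j) - 3)))"
    unfolding A0 B0 mat1_def by (simp_all only: double_fact_eq_hermite_coeff)
  fix L assume L: "cholesky M B L"
  \<comment> \<open>Uniqueness carries the identity for the explicit factor over to an arbitrary
    Cholesky factor.\<close>
  have "L = gauss_cholesky \<sigma> M"
    using cholesky_unique[OF L] cholesky_gauss_cholesky assms by blast
  then show DAD: "D * A * D = (1 / \<sigma>\<^sup>2) \<cdot>\<^sub>m (L * D * transpose_mat L)"
    using gauss_cholesky_diag assms by metis
  have carr: "L \<in> carrier_mat M M" "D \<in> carrier_mat M M"
    using L by (auto simp: cholesky_def assms(11) diag1_def)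
  have X: "inv_mat L \<in> carrier_mat M M"
    using inv_mat_inverts(1)[OF carr(1) cholesky_det_nonzero[OF L]] .
  have "inv_mat L * (D * A * D) * transpose_mat (inv_mat L)
      = (1 / \<sigma>\<^sup>2) \<cdot>\<^sub>m (inv_mat L * (L * D * transpose_mat L) * transpose_mat (inv_mat L))"
    unfolding DAD using carr X
    by (simp add: mult_smult_distrib[of _ M M _ M] mult_smult_assoc_mat[of _ M M _ M])
  also have "\<dots> = (1 / \<sigma>\<^sup>2) \<cdot>\<^sub>m D"
    using inv_mat_congruence[OF carr(1) cholesky_det_nonzero[OF L] carr(2)] by simp
  finally show "inv_mat L * (D * A * D) * transpose_mat (inv_mat L) = (1 / \<sigma>\<^sup>2) \<cdot>\<^sub>m D" .
qed

end
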